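(* For all positive integers $k,\ell$ there exists a real number $p=p_{k,\ell}>0$, depending only on $k$ and $\ell$, such that for every measurable function $f:\mathbb{R}^k\to\{0,1\}$ and every sequence $\{U_i\}_{i\in\mathbb{N}}$ of i.i.d. real-valued random variables, setting $Z^f_i=f(U_i,\dots,U_{i+k-1})$ for $i\ge 1$, one has $$\mathbb{P}(Z^f_1=Z^f_2=\dots=Z^f_\ell)>p.$$
   Context: $\mathbb{N}=\{1,2,3,\dots\}$. The process $Z^f_i=f(U_i,\dots,U_{i+k-1})$ is called a $k$-block factor (sliding window process). For $\ell=1$ the chain of equalities is vacuous, so the event has probability $1$. *)

theory Defs
  imports "HOL-Probability.Probability"
begin

text \<open>
  Points of \<open>\<real>\<^sup>k\<close> are functions on the index set \<open>{..<k}\<close>, so that \<open>k\<close> can be quantified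
  inside a formula; the sigma-algebra of \<open>\<Pi>\<^sub>M j\<in>{..<k}. borel\<close> is the Borel one.
\<close>

definition window_functions :: "nat \<Rightarrow> ((nat \<Rightarrow> real) \<Rightarrow> nat) set" where
  "window_functions k = measurable (\<Pi>\<^sub>M j\<in>{..<k}. (borel :: real measure)) (count_space {0, 1})"

text \<open>Sequences are indexed by the positive integers; the value of \<open>U\<close> at \<open>0\<close> plays no role.\<close>

definition iid_sequence :: "'a measure \<Rightarrow> (nat \<Rightarrow> 'a \<Rightarrow> real) \<Rightarrow> bool" where
  "iid_sequence M U \<longleftrightarrow>
     prob_space.indep_vars M (\<lambda>_. borel) U {1..} \<and>
     (\<forall>i\<ge>1. \<forall>j\<ge>1. distr M borel (U i) = distr M borel (U j))"

definition block_factor ::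
  "nat \<Rightarrow> ((nat \<Rightarrow> real) \<Rightarrow> nat) \<Rightarrow> (nat \<Rightarrow> 'a \<Rightarrow> real) \<Rightarrow> nat \<Rightarrow> 'a \<Rightarrow> nat" where
  "block_factor k f U i \<omega> = f (\<lambda>j\<in>{..<k}. U (i + j) \<omega>)"

definition run_bound :: "'a itself \<Rightarrow> nat \<Rightarrow> nat \<Rightarrow> real \<Rightarrow> bool" where
  "run_bound _ k l p \<longleftrightarrow>
     (\<forall>f \<in> window_functions k. \<forall>(M :: 'a measure) U.
        prob_space M \<longrightarrow> iid_sequence M U \<longrightarrow>
        measure M {\<omega> \<in> space M. \<forall>i\<in>{1..<l}.
          block_factor k f U i \<omega> = block_factor k f U (Suc i) \<omega>} > p)"

text \<open>
  Quantifying over all probability spaces involves a type variable for the sample space, and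
  type variables are quantified outermost: in \<open>\<exists>p>0. run_bound TYPE('a) k l p\<close> the number \<open>p\<close>
  could depend on \<open>'a\<close>. A \<open>p\<close> depending on \<open>k\<close> and \<open>l\<close> only is therefore expressed as
  existence of a \<open>p\<close> for the fixed type \<open>nat \<Rightarrow> real\<close>, together with the claim that every
  such \<open>p\<close> also serves for an arbitrary sample space type \<open>'a\<close>.
\<close>

end

theory Submission
  imports Defs "HOL-Library.Ramsey"
begin

text \<open>
  Ramsey's theorem gives an \<open>N\<close> such that every two-colouring of the \<open>k\<close>-subsets of
  \<open>{..<N}\<close> has a monochromatic subset of size \<open>k + l - 1\<close>. Colouring a \<open>k\<close>-set by the value of
  \<open>f\<close> at the samples with these indices, in increasing order, one sees that for every outcome
  some increasing subsequence of \<open>U 1, \<dots>, U N\<close> of length \<open>k + l - 1\<close> has equal window values. All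
  these subsequences have the law of \<open>U 1, \<dots>, U (k + l - 1)\<close>, so a union bound shows that the
  probability in question is at least \<open>1 / (N choose (k + l - 1))\<close>.
\<close>

section \<open>Ramsey's theorem for windows of increasing index sequences\<close>

lemma sorted_list_of_set_image_strict_mono_on:
  fixes g :: "nat \<Rightarrow> 'a::linorder"
  assumes "strict_mono_on {..<k} g"
  shows "sorted_list_of_set (g ` {..<k}) = map g [0..<k]"
proof -
  have "sorted_wrt (<) (map g [0..<k])"
    using assms by (auto simp: sorted_wrt_map sorted_wrt_iff_nth_less strict_mono_on_def)
  moreover have "set (map g [0..<k]) = g ` {..<k}"
    by (simp add: atLeast0LessThan)
  ultimately show ?thesis
    by (metis sorted_list_of_set.idem_if_sorted_distinct strict_sorted_iff)
qed

text \<open>Any \<open>k\<close> consecutive entries of the increasing enumeration of a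
  monochromatic \<open>H\<close> form a \<open>k\<close>-subset of \<open>H\<close>, so all windows
  inherit its colour.\<close>

lemma ramsey_monochromatic_windows:
  fixes k m :: nat
  shows "\<exists>N. \<forall>c :: (nat \<Rightarrow> nat) \<Rightarrow> nat. range c \<subseteq> {0, 1} \<longrightarrow>
    (\<exists>H\<in>nsets {..<N} m. \<exists>b. \<forall>i. i + k \<le> m \<longrightarrow>
      c (\<lambda>j\<in>{..<k}. sorted_list_of_set H ! (i + j)) = b)"
proof -
  \<comment> \<open>Both colours get the same target size \<open>m\<close>, so either one will
    do.\<close>
  obtain N :: nat where N: "partn_lst {..<N} [m, m] k"
    using ramsey_full by blast
  have "\<exists>H\<in>nsets {..<N} m. \<exists>b. \<forall>i. i + k \<le> m \<longrightarrow>
      c (\<lambda>j\<in>{..<k}. sorted_list_of_set H ! (i + j)) = b"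
    if c: "range c \<subseteq> {0, 1}" for c :: "(nat \<Rightarrow> nat) \<Rightarrow> nat"
  proof -
    \<comment> \<open>Listing a set in increasing order allows for a \<open>c\<close> that depends
      on the order of its arguments. On sets with fewer than \<open>k\<close> elements some entries
      are unspecified, but the colour still lies in \<open>{0, 1}\<close>.\<close>
    define g where "g T = c (\<lambda>j\<in>{..<k}. sorted_list_of_set T ! j)" for T
    have "g T < 2" for T
      using c unfolding g_def by (metis insertE less_2_cases_iff One_nat_def rangeI singletonD subsetD)
    then have "g \<in> nsets {..<N} k \<rightarrow> {..<2}"
      by auto
    then obtain b H where b: "b < length [m, m]" and "H \<in> nsets {..<N} ([m, m] ! b)"
      and mono: "g ` nsets H k \<subseteq> {b}"
      using partn_lstE[OF N, of g 2] by auto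
    then have H: "H \<in> nsets {..<N} m"
      by (auto simp: less_Suc_eq)
    then have fin: "finite H" and card: "card H = m"
      by (auto simp: nsets_def)
    let ?h = "\<lambda>i. sorted_list_of_set H ! i"
    have "c (\<lambda>j\<in>{..<k}. ?h (i + j)) = b" if i: "i + k \<le> m" for i
    proof -
      let ?T = "(\<lambda>j. ?h (i + j)) ` {..<k}"
      have len: "length (sorted_list_of_set H) = m"
        using card by simp
      have mon: "strict_mono_on {..<k} (\<lambda>j. ?h (i + j))"
        using i len strict_sorted_list_of_set[of H]
        by (auto simp: strict_mono_on_def sorted_wrt_iff_nth_less)
      have "?h (i + j) \<in> H" if "j < k" for j
        using that i len fin by (metis add_less_cancel_left nth_mem order_less_le_trans set_sorted_list_of_set)
      moreover have "card ?T = k"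
        using mon by (simp add: card_image strict_mono_on_imp_inj_on)
      ultimately have "?T \<in> nsets H k"
        by (auto simp: nsets_def)
      with mono have "g ?T = b"
        by auto
      moreover have "g ?T = c (\<lambda>j\<in>{..<k}. ?h (i + j))"
        unfolding g_def sorted_list_of_set_image_strict_mono_on[OF mon]
        by (rule arg_cong[of _ _ c]) auto
      ultimately show ?thesis
        by simp
    qed
    with H show ?thesis
      by blast
  qed
  then show ?thesis
    by (intro exI[of _ N] allI impI)
qed

section \<open>Joint laws of i.i.d. sequences\<close>

lemma (in prob_space) iid_sequence_measurable:
  assumes "iid_sequence M U" and "i \<ge> 1"
  shows "random_variable borel (U i)"
  using assms by (auto simp: iid_sequence_def indep_vars_def)

lemma (in prob_space) iid_sequence_distr:
  assumes U: "iid_sequence M U"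
  shows "distr M (\<Pi>\<^sub>M i\<in>{1..}. borel) (\<lambda>\<omega>. \<lambda>i\<in>{1..}. U i \<omega>) =
    (\<Pi>\<^sub>M i\<in>{1..}. distr M borel (U 1))"
proof -
  have "distr M (\<Pi>\<^sub>M i\<in>{1..}. borel) (\<lambda>\<omega>. \<lambda>i\<in>{1..}. U i \<omega>) =
      (\<Pi>\<^sub>M i\<in>{1..}. distr M borel (U i))"
    using U iid_sequence_measurable[OF U]
    by (subst indep_vars_iff_distr_eq_PiM'[symmetric]) (auto simp: iid_sequence_def)
  also have "\<dots> = (\<Pi>\<^sub>M i\<in>{1..}. distr M borel (U 1))"
    using U unfolding iid_sequence_def by (intro PiM_cong refl) (meson atLeast_iff order_refl)
  finally show ?thesis .
qed

text \<open>An injective choice of coordinates maps a product of identical factors to such a product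
  again, so the law does not depend on \<open>s\<close>.\<close>

lemma (in prob_space) iid_sequence_distr_reindex:
  assumes U: "iid_sequence M U" and s: "inj_on s I" "s \<in> I \<rightarrow> {1..}"
  shows "distr M (\<Pi>\<^sub>M i\<in>I. borel) (\<lambda>\<omega>. \<lambda>i\<in>I. U (s i) \<omega>) =
    (\<Pi>\<^sub>M i\<in>I. distr M borel (U 1))"
proof -
  let ?P = "\<Pi>\<^sub>M i\<in>{1..}. distr M borel (U 1)"
  have [measurable]: "random_variable borel (U i)" if "i \<ge> 1" for i
    using iid_sequence_measurable[OF U that] .
  have s1: "s i \<ge> 1" if "i \<in> I" for i
    using s that by auto
  have "distr M (\<Pi>\<^sub>M i\<in>I. borel) (\<lambda>\<omega>. \<lambda>i\<in>I. U (s i) \<omega>) =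
      distr M (\<Pi>\<^sub>M i\<in>I. borel) ((\<lambda>x. \<lambda>i\<in>I. x (s i)) \<circ> (\<lambda>\<omega>. \<lambda>i\<in>{1..}. U i \<omega>))"
    using s1 by (intro distr_cong) auto
  also have "\<dots> = distr (distr M (\<Pi>\<^sub>M i\<in>{1..}. borel) (\<lambda>\<omega>. \<lambda>i\<in>{1..}. U i \<omega>))
      (\<Pi>\<^sub>M i\<in>I. borel) (\<lambda>x. \<lambda>i\<in>I. x (s i))"
    using s1 by (intro distr_distr[symmetric] measurable_restrict measurable_component_singleton) auto
  also have "\<dots> = distr ?P (\<Pi>\<^sub>M i\<in>I. distr M borel (U 1)) (\<lambda>x. \<lambda>i\<in>I. x (s i))"
    unfolding iid_sequence_distr[OF U] by (intro distr_cong sets_PiM_cong) auto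
  also have "\<dots> = (\<Pi>\<^sub>M i\<in>I. distr M borel (U 1))"
    using s by (intro distr_PiM_reindex prob_space_distr) auto
  finally show ?thesis .
qed

section \<open>Constant runs as events on paths\<close>

text \<open>Stated for a single path, so that it applies to \<open>U\<close>, to its subsequences
  and to coordinate processes alike.\<close>

definition constant_run :: "nat \<Rightarrow> nat \<Rightarrow> ((nat \<Rightarrow> real) \<Rightarrow> nat) \<Rightarrow> (nat \<Rightarrow> real) \<Rightarrow> bool" where
  "constant_run k l f x \<longleftrightarrow>
     (\<forall>i\<in>{1..<l}. f (\<lambda>j\<in>{..<k}. x (i + j)) = f (\<lambda>j\<in>{..<k}. x (Suc i + j)))"

text \<open>The last window starts at \<open>l\<close> and ends at \<open>k + l - 1\<close>, so no
  later coordinate enters.\<close>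

lemma constant_run_cong:
  assumes "\<And>j. j \<in> {1..<k + l} \<Longrightarrow> x j = y j"
  shows "constant_run k l f x \<longleftrightarrow> constant_run k l f y"
proof -
  have "(\<lambda>j\<in>{..<k}. x (i + j)) = (\<lambda>j\<in>{..<k}. y (i + j))" if "i \<in> {1..l}" for i
    using that assms by (intro restrict_ext) auto
  then show ?thesis
    by (auto simp: constant_run_def simp del: add_Suc)
qed

lemma measurable_constant_run:
  assumes f: "f \<in> window_functions k" and I: "{1..<k + l} \<subseteq> I"
  shows "{x \<in> space (\<Pi>\<^sub>M i\<in>I. borel). constant_run k l f x} \<in> sets (\<Pi>\<^sub>M i\<in>I. borel)"
proof -
  have meas: "(\<lambda>x. f (\<lambda>j\<in>{..<k}. x (i + j))) \<in> measurable (\<Pi>\<^sub>M i\<in>I. borel) (count_space UNIV)"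
    if "i \<in> {1..l}" for i
  proof -
    \<comment> \<open>The codomain is widened so that equality of two window values becomes a
      measurable event.\<close>
    have f': "f \<in> measurable (\<Pi>\<^sub>M j\<in>{..<k}. borel) (count_space UNIV)"
      using measurable_compose[OF f[unfolded window_functions_def], of id "count_space UNIV"]
      by (simp add: comp_def)
    have "(\<lambda>x. \<lambda>j\<in>{..<k}. x (i + j)) \<in> measurable (\<Pi>\<^sub>M i\<in>I. borel) (\<Pi>\<^sub>M j\<in>{..<k}. (borel :: real measure))"
      using that I by (intro measurable_restrict measurable_component_singleton) auto
    then show ?thesis
      by (rule measurable_compose[OF _ f'])
  qed
  have "{x \<in> space (\<Pi>\<^sub>M i\<in>I. borel). f (\<lambda>j\<in>{..<k}. x (i + j)) = f (\<lambda>j\<in>{..<k}. x (Suc i + j))}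
      \<in> sets (\<Pi>\<^sub>M i\<in>I. borel)" if "i \<in> {1..<l}" for i
  proof -
    have [measurable]: "(\<lambda>x. f (\<lambda>j\<in>{..<k}. x (i + j))) \<in> measurable (\<Pi>\<^sub>M i\<in>I. borel) (count_space UNIV)"
      "(\<lambda>x. f (\<lambda>j\<in>{..<k}. x (Suc i + j))) \<in> measurable (\<Pi>\<^sub>M i\<in>I. borel) (count_space UNIV)"
      using that by (auto intro!: meas simp del: add_Suc)
    show ?thesis
      by measurable
  qed
  then show ?thesis
    unfolding constant_run_def by (intro sets.sets_Collect_finite_All) auto
qed

text \<open>The event sees only the selected samples, whose joint law is the same for every
  injective \<open>s\<close>. This makes all summands of the union bound equal.\<close>

lemma (in prob_space) iid_sequence_constant_run:
  assumes U: "iid_sequence M U" and f: "f \<in> window_functions k"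
    and s: "inj_on s {1..<k + l}" "s \<in> {1..<k + l} \<rightarrow> {1..}"
  shows "{\<omega> \<in> space M. constant_run k l f (\<lambda>i. U (s i) \<omega>)} \<in> events"
    and "prob {\<omega> \<in> space M. constant_run k l f (\<lambda>i. U (s i) \<omega>)} =
      measure (\<Pi>\<^sub>M i\<in>{1..<k + l}. distr M borel (U 1))
        {x \<in> space (\<Pi>\<^sub>M i\<in>{1..<k + l}. borel). constant_run k l f x}"
proof -
  let ?I = "{1..<k + l}"
  let ?B = "\<Pi>\<^sub>M i\<in>?I. (borel :: real measure)"
  let ?E = "{x \<in> space ?B. constant_run k l f x}"
  let ?X = "\<lambda>\<omega>. \<lambda>i\<in>?I. U (s i) \<omega>"
  have X: "?X \<in> measurable M ?B"
    using s by (intro measurable_restrict iid_sequence_measurable[OF U]) auto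
  have E: "?E \<in> sets ?B"
    by (rule measurable_constant_run[OF f order_refl])
  have "constant_run k l f (?X \<omega>) \<longleftrightarrow> constant_run k l f (\<lambda>i. U (s i) \<omega>)" for \<omega>
    by (rule constant_run_cong) simp
  then have eq: "{\<omega> \<in> space M. constant_run k l f (\<lambda>i. U (s i) \<omega>)} = ?X -` ?E \<inter> space M"
    using measurable_space[OF X] by auto
  show "{\<omega> \<in> space M. constant_run k l f (\<lambda>i. U (s i) \<omega>)} \<in> events"
    unfolding eq using X E by (rule measurable_sets)
  show "prob {\<omega> \<in> space M. constant_run k l f (\<lambda>i. U (s i) \<omega>)} =
      measure (\<Pi>\<^sub>M i\<in>?I. distr M borel (U 1)) ?E"
    unfolding eq measure_distr[OF X E, symmetric] iid_sequence_distr_reindex[OF U s] ..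
qed

section \<open>Positive lower bound for the run probability\<close>

lemma run_bound_iff_constant_run:
  "run_bound TYPE('a) k l p \<longleftrightarrow>
     (\<forall>f \<in> window_functions k. \<forall>(M :: 'a measure) U. prob_space M \<longrightarrow> iid_sequence M U \<longrightarrow>
        measure M {\<omega> \<in> space M. constant_run k l f (\<lambda>i. U i \<omega>)} > p)"
  by (simp add: run_bound_def constant_run_def block_factor_def)

lemma ex_run_bound:
  assumes "k \<ge> 1" and "l \<ge> 1"
  shows "\<exists>p>0. run_bound TYPE('a) k l p"
proof -
  define m where "m = k + l - 1"
  obtain N where N: "\<And>c :: (nat \<Rightarrow> nat) \<Rightarrow> nat. range c \<subseteq> {0, 1} \<Longrightarrow>
    \<exists>H\<in>nsets {..<N} m. \<exists>b. \<forall>i. i + k \<le> m \<longrightarrow>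
      c (\<lambda>j\<in>{..<k}. sorted_list_of_set H ! (i + j)) = b"
    using ramsey_monochromatic_windows[of m k] by metis
  define C where "C = N choose m"
  \<comment> \<open>The union bound yields only \<open>1 \<le> real C * ?P\<close>; the extra
    \<open>1\<close> in the denominator makes the inequality strict.\<close>
  have "measure M {\<omega> \<in> space M. constant_run k l f (\<lambda>i. U i \<omega>)} > 1 / (1 + real C)"
    if f: "f \<in> window_functions k" and M: "prob_space M" and U: "iid_sequence M U"
    for f and M :: "'a measure" and U
  proof -
    interpret prob_space M by (rule M)
    let ?P = "prob {\<omega> \<in> space M. constant_run k l f (\<lambda>i. U i \<omega>)}"
    \<comment> \<open>Positions \<open>1, 2, ...\<close> become list indices
      \<open>0, 1, ...\<close>, and elements of \<open>{..<N}\<close> become sample indices in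
      \<open>{1..N}\<close>.\<close>
    define s where "s H i = Suc (sorted_list_of_set H ! (i - 1))" for H :: "nat set" and i
    define A where "A H = {\<omega> \<in> space M. constant_run k l f (\<lambda>i. U (s H i) \<omega>)}" for H
    have A: "A H \<in> events" "prob (A H) = ?P" if "H \<in> nsets {..<N} m" for H
    proof -
      have "inj_on (s H) {1..<k + l}"
      proof (rule inj_onI)
        fix i j assume ij: "i \<in> {1..<k + l}" "j \<in> {1..<k + l}" "s H i = s H j"
        moreover have "length (sorted_list_of_set H) = m"
          using that by (simp add: nsets_def)
        ultimately have "i - 1 = j - 1"
          by (subst nth_eq_iff_index_eq[symmetric, of "sorted_list_of_set H"]) (auto simp: s_def m_def)
        with ij show "i = j"
          by auto
      qed
      \<comment> \<open>Comparing with the identity selection shows that the common probability is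
        \<open>?P\<close>.\<close>
      then show "A H \<in> events" "prob (A H) = ?P"
        unfolding A_def using iid_sequence_constant_run[OF U f, of "s H" l]
          iid_sequence_constant_run[OF U f, of "\<lambda>i. i" l] by (auto simp: s_def)
    qed
    have "space M \<subseteq> (\<Union>H\<in>nsets {..<N} m. A H)"
    proof
      fix \<omega> assume \<omega>: "\<omega> \<in> space M"
      \<comment> \<open>The colouring, and hence \<open>H\<close>, varies with
        \<open>\<omega>\<close>; no measurable choice of \<open>H\<close> is required, since only
        the union of the \<open>A H\<close> is used.\<close>
      define c where "c t = f (\<lambda>j\<in>{..<k}. U (Suc (t j)) \<omega>)" for t
      have "c t \<in> {0, 1}" for t
        using measurable_space[OF f[unfolded window_functions_def]]
        unfolding c_def by (simp add: space_PiM)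
      then have "range c \<subseteq> {0, 1}"
        by (rule image_subsetI)
      then obtain H b where H: "H \<in> nsets {..<N} m"
        and b: "\<And>i. i + k \<le> m \<Longrightarrow> c (\<lambda>j\<in>{..<k}. sorted_list_of_set H ! (i + j)) = b"
        using N[of c] by blast
      \<comment> \<open>Window \<open>i\<close> is the Ramsey window at offset \<open>i - 1\<close>,
        and \<open>i \<le> l\<close> amounts to \<open>i - 1 + k \<le> m\<close>.\<close>
      have "f (\<lambda>j\<in>{..<k}. U (s H (i + j)) \<omega>) = b" if "i \<in> {1..l}" for i
      proof -
        have "f (\<lambda>j\<in>{..<k}. U (s H (i + j)) \<omega>) =
            c (\<lambda>j\<in>{..<k}. sorted_list_of_set H ! (i - 1 + j))"
          using that unfolding c_def s_def by (intro arg_cong[of _ _ f] restrict_ext) auto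
        also have "\<dots> = b"
          using that by (intro b) (auto simp: m_def)
        finally show ?thesis .
      qed
      then have "constant_run k l f (\<lambda>i. U (s H i) \<omega>)"
        by (auto simp: constant_run_def simp del: add_Suc)
      with \<omega> H show "\<omega> \<in> (\<Union>H\<in>nsets {..<N} m. A H)"
        by (auto simp: A_def)
    qed
    then have "1 \<le> prob (\<Union>H\<in>nsets {..<N} m. A H)"
      using A(1) finite_measure_mono[of "space M"] prob_space
      by (metis (no_types, lifting) finite_imp_finite_nsets finite_lessThan sets.finite_UN)
    also have "\<dots> \<le> (\<Sum>H\<in>nsets {..<N} m. prob (A H))"
      using A(1) by (intro finite_measure_subadditive_finite) (auto intro: finite_imp_finite_nsets)
    also have "\<dots> = real C * ?P"
      using A(2) by (simp add: C_def)
    finally have *: "1 \<le> real C * ?P" .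
    then have "?P > 0"
      by (metis measure_nonneg less_eq_real_def mult_zero_right not_one_le_zero)
    with * have "1 < (1 + real C) * ?P"
      by (simp add: algebra_simps)
    then show ?thesis
      by (simp add: divide_less_eq mult.commute)
  qed
  then show ?thesis
    unfolding run_bound_iff_constant_run by (intro exI[of _ "1 / (1 + real C)"]) auto
qed

text \<open>
  The probability depends on the law of \<open>U\<close> only, which is also the law of the coordinates on
  the path space \<open>nat \<Rightarrow> real\<close>.
\<close>

lemma run_bound_path_space:
  assumes p: "run_bound TYPE(nat \<Rightarrow> real) k l p"
  shows "run_bound TYPE('a) k l p"
  unfolding run_bound_iff_constant_run
proof (intro ballI allI impI)
  fix f and M :: "'a measure" and U
  assume f: "f \<in> window_functions k" and "prob_space M" and U: "iid_sequence M U"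
  interpret prob_space M by fact
  define D where "D = distr M borel (U 1)"
  define Q where "Q = (\<Pi>\<^sub>M i\<in>{1::nat..}. D)"
  define V where "V i x = x i" for i :: nat and x :: "nat \<Rightarrow> real"
  interpret D: prob_space D
    unfolding D_def using iid_sequence_measurable[OF U] by (intro prob_space_distr) simp
  interpret Q: prob_space Q
    unfolding Q_def by (intro prob_space_PiM D.prob_space_axioms)
  have sets_D: "sets D = sets borel"
    by (simp add: D_def)
  have V: "V i \<in> measurable Q borel" if "i \<ge> 1" for i
    using that measurable_component_singleton[of i "{1..}" "\<lambda>_. D"]
    unfolding V_def Q_def measurable_cong_sets[OF refl sets_D] by simp
  have distr_V: "distr Q borel (V i) = D" if "i \<ge> 1" for i
  proof -
    have "distr Q borel (V i) = distr Q D (V i)"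
      using sets_D by (intro distr_cong) auto
    also have "\<dots> = D"
      unfolding Q_def V_def using that by (intro distr_PiM_component D.prob_space_axioms) auto
    finally show ?thesis .
  qed
  \<comment> \<open>Paths in \<open>Q\<close> are extensional, so restricting to
    \<open>{1..}\<close> is the identity and the joint law of the \<open>V i\<close> is
    \<open>Q\<close>; being a product, it gives independence.\<close>
  have "distr Q (\<Pi>\<^sub>M i\<in>{1..}. borel) (\<lambda>x. \<lambda>i\<in>{1..}. V i x) = distr Q Q (\<lambda>x. x)"
    unfolding V_def Q_def
    by (intro distr_cong sets_PiM_cong) (auto simp: sets_D space_PiM PiE_restrict)
  also have "\<dots> = (\<Pi>\<^sub>M i\<in>{1..}. distr Q borel (V i))"
    unfolding distr_id by (subst Q_def, intro PiM_cong) (auto simp: distr_V)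
  finally have "iid_sequence Q V"
    unfolding iid_sequence_def using V distr_V
    by (subst Q.indep_vars_iff_distr_eq_PiM') auto
  then have "p < Q.prob {x \<in> space Q. constant_run k l f (\<lambda>i. V i x)}"
    using p f Q.prob_space_axioms unfolding run_bound_iff_constant_run by blast
  \<comment> \<open>Both sides are the measure of the same set under the product of
    \<open>k + l - 1\<close> copies of \<open>D\<close>.\<close>
  also have "\<dots> = prob {\<omega> \<in> space M. constant_run k l f (\<lambda>i. U i \<omega>)}"
    using Q.iid_sequence_constant_run(2)[OF \<open>iid_sequence Q V\<close> f, of "\<lambda>i. i" l]
      iid_sequence_constant_run(2)[OF U f, of "\<lambda>i. i" l]
    by (simp add: distr_V D_def)
  finally show "p < prob {\<omega> \<in> space M. constant_run k l f (\<lambda>i. U i \<omega>)}" .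
qed

theorem mainTheorem4:
  fixes k l :: nat
  assumes "k \<ge> 1" and "l \<ge> 1"
  shows "(\<exists>p>0. run_bound TYPE(nat \<Rightarrow> real) k l p) \<and>
         (\<forall>p. run_bound TYPE(nat \<Rightarrow> real) k l p \<longrightarrow> run_bound TYPE('a) k l p)"
  using ex_run_bound[OF assms] run_bound_path_space by blast

end
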